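(* Let $\mathcal X$ be a quasi-controllable $\mathcal O$-family which is Lyapunov stable. Then $$\mathrm{ovm}(\mathcal X)\le \bigl(\mathrm{qcm}(\mathcal X)\bigr)^{-1}.$$
   Context: Fix a positive integer $N$ and a norm $\|\cdot\|$ on $\mathbb R^N$. Let $\mathcal T$ be either the half-axis $\{t\in\mathbb R: t\ge 0\}$ or the set of all nonnegative integers. Let $\mathcal X$ be a collection of functions $x:\mathcal T\to\mathbb R^N$. For $u\in\mathbb R^N$ and $s,t\in\mathcal T$, $s\le t$, put $\mathcal X(u,t,s)=\{x(t): x(\cdot)\in\mathcal X,\ x(s)=u\}$. $\mathcal X$ is called an $\mathcal O$-family if it satisfies: (1) sewing condition: for all $t_1\le t_2\le t_3$ in $\mathcal T$ and all $x,y\in\mathcal X$ with $x(t_2)=y(t_2)$ there is $z\in\mathcal X$ with $z(t)=x(t)$ for $t_1\le t\le t_2$ and $z(t)=y(t)$ for $t_2\le t\le t_3$; (2) homogeneity: $\mathcal X(\lambda u,t,0)=\lambda\mathcal X(u,t,0)$ for $u\in\mathbb R^N$, $t\in\mathcal T$, $\lambda\in\mathbb R$; (3) time invariance: $\mathcal X(u,t,s)=\mathcal X(u,t-s,0)$ for $u\in\mathbb R^N$, $s\le t$ in $\mathcal T$; (4) concavity: $\mathcal X(\lambda u+(1-\lambda)v,t,0)\subseteq\lambda\mathcal X(u,t,0)+(1-\lambda)\mathcal X(v,t,0)$ for $u,v\in\mathbb R^N$, $t\in\mathcal T$, $\lambda\in[0,1]$ (Minkowski sum); (5) local boundedness: there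 is a continuous function $\rho(t)$ such that $\|x\|\le\rho(t)$ for all $x\in\mathcal X(u,t,0)$, $\|u\|=1$, $t\in\mathcal T$; (6) continuity: if $x_n\to x_0$ in $\mathbb R^N$, then $H(\mathcal X(x_n,t,0),\mathcal X(x_0,t,0))\to0$ for every $t\in\mathcal T$, where $H$ is the Hausdorff distance between sets in $\mathbb R^N$. A subspace $E\subseteq\mathbb R^N$ is invariant with respect to $\mathcal X$ if $\mathcal X(x,t,0)\subseteq E$ for all $x\in E$, $t\in\mathcal T$. An $\mathcal O$-family is quasi-controllable if there is no nonzero proper subspace of $\mathbb R^N$ invariant with respect to it. Let $\mathcal S$ be the set of all $s\in\mathcal T$ such that the set $\{t\in\mathcal T:0\le t\le s\}$ has at least $N$ elements. Let $\mathbf S(\rho)$ be the ball of radius $\rho$ centered at $0$ in the norm $\|\cdot\|$, and let $\mathrm{absco}(W)=\mathrm{co}(W\cup(-W))$ be the absolute convex hull of $W\subseteq\mathbb R^N$. For $s\in\mathcal T$ the $s$-measure of quasi-controllability is $$\mathrm{qcm}_s(\mathcal X)=\inf_{x\in\mathbb R^N,\ \|x\|=1}\ \sup\Bigl\{\rho:\ \mathbf S(\rho)\subseteq\mathrm{absco}\Bigl(\bigcup_{t\in\mathcal T,\,0\le t\le s}\mathcal X(x,t,0)\Bigr)\Bigr\},$$ and the quasi-controllability measure is $\mathrm{qcm}(\mathcal X)=\sup_{s\in\mathcal S}\mathrm{qcm}_s(\mathcal X)$. An $\mathcal O$-family $\mathcal X$ is Lyapunov stable if for some $\mu>0$, for all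 $x\in\mathbb R^N$, $\sup\{\|u\|: u\in\bigcup_{t\in\mathcal T}\mathcal X(x,t,0)\}\le\mu\|x\|$. The overshooting measure $\mathrm{ovm}(\mathcal X)$ is the greatest lower bound of those $\mu$ for which this inequality holds (for all $x$). *)

theory Defs
  imports "HOL-Analysis.Analysis"
begin

text \<open>
  The space of dimension N is \<open>real ^ 'n\<close> with \<open>N = CARD('n)\<close>.  The norm of the statement is
  arbitrary, so it is a parameter \<open>nrm\<close>, unrelated to the Euclidean \<open>norm\<close>.  Convergence in
  \<open>real ^ 'n\<close> is the library's; it is the same for every norm.

  Functions from the time set \<open>T\<close> are represented by total functions on \<open>real\<close>; no definition
  below looks at their values outside \<open>T\<close>.
\<close>

definition is_norm :: "(real ^ 'n \<Rightarrow> real) \<Rightarrow> bool" where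
  "is_norm nrm \<longleftrightarrow>
     (\<forall>x. 0 \<le> nrm x) \<and> (\<forall>x. nrm x = 0 \<longleftrightarrow> x = 0) \<and>
     (\<forall>c x. nrm (c *\<^sub>R x) = \<bar>c\<bar> * nrm x) \<and>
     (\<forall>x y. nrm (x + y) \<le> nrm x + nrm y)"

definition time_set :: "real set \<Rightarrow> bool" where
  "time_set T \<longleftrightarrow> T = {t. 0 \<le> t} \<or> T = \<nat>"

definition reach :: "(real \<Rightarrow> real ^ 'n) set \<Rightarrow> real ^ 'n \<Rightarrow> real \<Rightarrow> real \<Rightarrow> (real ^ 'n) set" where
  "reach X u t s = {x t | x. x \<in> X \<and> x s = u}"

text \<open>Hausdorff distance; \<open>ennreal\<close> makes it total, also for empty and unbounded sets.\<close>

definition hausdorff :: "(real ^ 'n \<Rightarrow> real) \<Rightarrow> (real ^ 'n) set \<Rightarrow> (real ^ 'n) set \<Rightarrow> ennreal" where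
  "hausdorff nrm A B =
     max (SUP a\<in>A. INF b\<in>B. ennreal (nrm (a - b))) (SUP b\<in>B. INF a\<in>A. ennreal (nrm (a - b)))"

text \<open>In the concavity condition, \<open>+\<close> on sets is the Minkowski sum of \<open>HOL-Library.Set_Algebras\<close>.\<close>

definition O_family :: "real set \<Rightarrow> (real ^ 'n \<Rightarrow> real) \<Rightarrow> (real \<Rightarrow> real ^ 'n) set \<Rightarrow> bool" where
  "O_family T nrm X \<longleftrightarrow>
     \<comment> \<open>sewing\<close>
     (\<forall>t1\<in>T. \<forall>t2\<in>T. \<forall>t3\<in>T. t1 \<le> t2 \<longrightarrow> t2 \<le> t3 \<longrightarrow>
        (\<forall>x\<in>X. \<forall>y\<in>X. x t2 = y t2 \<longrightarrow>
           (\<exists>z\<in>X. (\<forall>t\<in>T. t1 \<le> t \<and> t \<le> t2 \<longrightarrow> z t = x t) \<and>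
                  (\<forall>t\<in>T. t2 \<le> t \<and> t \<le> t3 \<longrightarrow> z t = y t)))) \<and>
     \<comment> \<open>homogeneity\<close>
     (\<forall>u. \<forall>t\<in>T. \<forall>c. reach X (c *\<^sub>R u) t 0 = (\<lambda>y. c *\<^sub>R y) ` reach X u t 0) \<and>
     \<comment> \<open>time invariance\<close>
     (\<forall>u. \<forall>s\<in>T. \<forall>t\<in>T. s \<le> t \<longrightarrow> reach X u t s = reach X u (t - s) 0) \<and>
     \<comment> \<open>concavity\<close>
     (\<forall>u v. \<forall>t\<in>T. \<forall>c\<in>{0..1}.
        reach X (c *\<^sub>R u + (1 - c) *\<^sub>R v) t 0
          \<subseteq> (\<lambda>y. c *\<^sub>R y) ` reach X u t 0 + (\<lambda>y. (1 - c) *\<^sub>R y) ` reach X v t 0) \<and>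
     \<comment> \<open>local boundedness\<close>
     (\<exists>\<rho>. continuous_on T \<rho> \<and>
        (\<forall>t\<in>T. \<forall>u. nrm u = 1 \<longrightarrow> (\<forall>x\<in>reach X u t 0. nrm x \<le> \<rho> t))) \<and>
     \<comment> \<open>continuity\<close>
     (\<forall>xs x0. xs \<longlonglongrightarrow> x0 \<longrightarrow>
        (\<forall>t\<in>T. (\<lambda>n. hausdorff nrm (reach X (xs n) t 0) (reach X x0 t 0)) \<longlonglongrightarrow> 0))"

definition invariant_subspace :: "real set \<Rightarrow> (real \<Rightarrow> real ^ 'n) set \<Rightarrow> (real ^ 'n) set \<Rightarrow> bool" where
  "invariant_subspace T X E \<longleftrightarrow> subspace E \<and> (\<forall>x\<in>E. \<forall>t\<in>T. reach X x t 0 \<subseteq> E)"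

definition quasi_controllable :: "real set \<Rightarrow> (real \<Rightarrow> real ^ 'n) set \<Rightarrow> bool" where
  "quasi_controllable T X \<longleftrightarrow> \<not> (\<exists>E. invariant_subspace T X E \<and> E \<noteq> {0} \<and> E \<noteq> UNIV)"

text \<open>The set of admissible \<open>s\<close>; \<open>card\<close> of an infinite set is 0, hence the disjunction.\<close>

definition long_times :: "real set \<Rightarrow> nat \<Rightarrow> real set" where
  "long_times T N =
     {s \<in> T. infinite {t \<in> T. 0 \<le> t \<and> t \<le> s} \<or> N \<le> card {t \<in> T. 0 \<le> t \<and> t \<le> s}}"

definition nrm_ball :: "(real ^ 'n \<Rightarrow> real) \<Rightarrow> real \<Rightarrow> (real ^ 'n) set" where
  "nrm_ball nrm \<rho> = {x. nrm x \<le> \<rho>}"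

definition absco :: "(real ^ 'n) set \<Rightarrow> (real ^ 'n) set" where
  "absco W = convex hull (W \<union> uminus ` W)"

text \<open>
  The measures below are real, with the library's real \<open>Sup\<close> and \<open>Inf\<close>.  For an O-family the
  supremum over \<open>\<rho>\<close> is over a bounded set by local boundedness, and over a nonempty one because
  \<open>nrm_ball nrm \<rho>\<close> is empty for \<open>\<rho> < 0\<close>.  The supremum over \<open>s\<close> in \<open>qcm\<close> is bounded when the
  family is nonempty and Lyapunov stable (by any stability constant \<open>\<mu>\<close>); for an empty family
  it is 0.
\<close>

definition qcm_s ::
  "real set \<Rightarrow> (real ^ 'n \<Rightarrow> real) \<Rightarrow> (real \<Rightarrow> real ^ 'n) set \<Rightarrow> real \<Rightarrow> real" where
  "qcm_s T nrm X s =
     (INF x\<in>{x. nrm x = 1}.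
        Sup {\<rho>. nrm_ball nrm \<rho> \<subseteq> absco (\<Union>t\<in>{t \<in> T. 0 \<le> t \<and> t \<le> s}. reach X x t 0)})"

definition qcm :: "real set \<Rightarrow> (real ^ 'n \<Rightarrow> real) \<Rightarrow> (real \<Rightarrow> real ^ 'n) set \<Rightarrow> real" where
  "qcm T nrm X = (SUP s\<in>long_times T CARD('n). qcm_s T nrm X s)"

text \<open>The supremum is taken in \<open>ennreal\<close>, so that an unbounded set violates the inequality.\<close>

definition stability_bound ::
  "real set \<Rightarrow> (real ^ 'n \<Rightarrow> real) \<Rightarrow> (real \<Rightarrow> real ^ 'n) set \<Rightarrow> real \<Rightarrow> bool" where
  "stability_bound T nrm X \<mu> \<longleftrightarrow>
     (\<forall>x. (SUP u\<in>(\<Union>t\<in>T. reach X x t 0). ennreal (nrm u)) \<le> ennreal (\<mu> * nrm x))"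

definition lyapunov_stable ::
  "real set \<Rightarrow> (real ^ 'n \<Rightarrow> real) \<Rightarrow> (real \<Rightarrow> real ^ 'n) set \<Rightarrow> bool" where
  "lyapunov_stable T nrm X \<longleftrightarrow> (\<exists>\<mu>>0. stability_bound T nrm X \<mu>)"

definition ovm :: "real set \<Rightarrow> (real ^ 'n \<Rightarrow> real) \<Rightarrow> (real \<Rightarrow> real ^ 'n) set \<Rightarrow> real" where
  "ovm T nrm X = Inf {\<mu>. \<mu> > 0 \<and> stability_bound T nrm X \<mu>}"

end

theory Submission
  imports Defs
begin

text \<open>
  Write \<open>g(u)\<close> (\<open>peak\<close> below) for the supremum of the norm over the orbit of \<open>u\<close>, the set of
  all points reachable from \<open>u\<close>.  Lyapunov stability makes \<open>g\<close> finite, homogeneity and concavity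
  make it a seminorm dominating the given norm, and sewing with time invariance make it
  nonincreasing along orbits: \<open>g(z) \<le> g(u)\<close> for \<open>z\<close> in the orbit of \<open>u\<close>.  A seminorm bounded by
  \<open>g(z)\<close> on the orbit of \<open>z\<close> is bounded by \<open>g(z)\<close> on its absolute convex hull.

  Let \<open>0 < r < qcm_s\<close>.  Then the hull of the orbit of a unit vector \<open>z\<close> contains the ball of
  radius \<open>r\<close>, so \<open>r g(w) \<parallel>z\<parallel> \<le> g(z) \<parallel>w\<parallel>\<close> for all nonzero \<open>w\<close>, \<open>z\<close>.  For \<open>z\<close> in the orbit of \<open>w\<close>
  the right-hand side is at most \<open>g(w) \<parallel>w\<parallel>\<close>, and the supremum over these \<open>z\<close> gives
  \<open>r g(w)\<^sup>2 \<le> g(w) \<parallel>w\<parallel>\<close>, that is \<open>g(w) \<le> \<parallel>w\<parallel> / r\<close>.  Hence \<open>1 / r\<close> is a stability constant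
  (\<open>stability_bound_inverse_radius\<close>); letting \<open>r\<close> increase to \<open>qcm\<close> gives the theorem, once
  \<open>qcm\<close> is known to be positive.

  Positivity (\<open>qcm_pos\<close>) is a compactness argument by duality.  If the measure vanished, there
  would be unit vectors \<open>x\<^sub>n\<close> whose orbits up to times tending to infinity have hulls missing
  points that tend to 0.  Separation gives unit functionals \<open>f\<^sub>n\<close> that are uniformly small on these
  orbits.  A limit functional \<open>f\<close> annihilates, by continuity of the reachable sets, the whole
  orbit of a limit point \<open>x\<close>.  But the span of that orbit is an invariant subspace containing
  \<open>x \<noteq> 0\<close>, so by quasi-controllability it is the whole space, and \<open>f = 0\<close>.
\<close>

section \<open>Arbitrary norms on a Euclidean space\<close>

text \<open>A norm is a finite convex function, and these are continuous in finite dimension.\<close>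

lemma is_norm_continuous:
  assumes "is_norm nrm"
  shows "continuous_on UNIV nrm"
proof -
  have "convex_on UNIV nrm"
  proof (rule convex_onI)
    fix t x y assume "0 < t" "t < (1::real)"
    have "nrm ((1 - t) *\<^sub>R x + t *\<^sub>R y) \<le> nrm ((1 - t) *\<^sub>R x) + nrm (t *\<^sub>R y)"
      using assms unfolding is_norm_def by blast
    also have "\<dots> = (1 - t) * nrm x + t * nrm y"
      using assms \<open>0 < t\<close> \<open>t < 1\<close> unfolding is_norm_def by simp
    finally show "nrm ((1 - t) *\<^sub>R x + t *\<^sub>R y) \<le> (1 - t) * nrm x + t * nrm y" .
  qed simp
  then show ?thesis
    by (intro convex_on_continuous) auto
qed

text \<open>
  The constant is the inverse of the minimum of \<open>nrm\<close> on the Euclidean unit sphere, which is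
  attained, hence positive.
\<close>

lemma is_norm_dominates_norm:
  assumes "is_norm nrm"
  obtains c where "c > 0" "\<And>x. norm x \<le> c * nrm x"
proof -
  have "\<exists>x::real^'n. x \<in> sphere 0 1"
    using vector_choose_size[of 1] by auto
  then have "\<exists>z\<in>sphere 0 1. \<forall>x\<in>sphere 0 1. nrm z \<le> nrm x"
    by (intro continuous_attains_inf)
       (auto intro: continuous_on_subset[OF is_norm_continuous[OF assms]])
  then obtain z where z: "norm z = 1" "\<And>x. norm x = 1 \<Longrightarrow> nrm z \<le> nrm x"
    by auto
  have pos: "nrm z > 0"
    using z(1) assms unfolding is_norm_def by (metis less_eq_real_def norm_zero zero_neq_one)
  have "norm x \<le> inverse (nrm z) * nrm x" for x
  proof (cases "x = 0")
    case True
    then show ?thesis using assms unfolding is_norm_def by simp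
  next
    case False
    have "nrm z \<le> nrm (inverse (norm x) *\<^sub>R x)"
      using False by (intro z(2)) simp
    also have "\<dots> = inverse (norm x) * nrm x"
      using assms unfolding is_norm_def by simp
    finally show ?thesis
      using False pos by (simp add: field_simps)
  qed
  then show ?thesis
    using that pos by (metis positive_imp_inverse_positive)
qed

lemma is_norm_compact_sphere:
  assumes "is_norm nrm"
  shows "compact {x. nrm x = 1}"
proof -
  obtain c where "\<And>x. norm x \<le> c * nrm x"
    using is_norm_dominates_norm[OF assms] by blast
  then have "bounded {x. nrm x = 1}"
    by (intro boundedI[of _ c]) (metis mem_Collect_eq mult.right_neutral)
  moreover have "closed {x. nrm x = 1}"
    using is_norm_continuous[OF assms] by (intro closed_Collect_eq) auto
  ultimately show ?thesis
    by (simp add: compact_eq_bounded_closed)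
qed

lemma is_norm_attains:
  fixes nrm :: "real ^ 'n \<Rightarrow> real"
  assumes "is_norm nrm" "0 \<le> a"
  obtains x where "nrm x = a"
proof -
  obtain y :: "real^'n" where "y \<noteq> 0"
    using vector_choose_size[of 1] by (metis norm_zero zero_le_one zero_neq_one)
  then have "nrm y > 0"
    using assms unfolding is_norm_def by (metis less_eq_real_def)
  then have "nrm ((a / nrm y) *\<^sub>R y) = a"
    using assms \<open>y \<noteq> 0\<close> unfolding is_norm_def by simp
  then show ?thesis using that by blast
qed

section \<open>Orbits\<close>

definition orbit_upto where
  "orbit_upto T X x s = (\<Union>t\<in>{t \<in> T. 0 \<le> t \<and> t \<le> s}. reach X x t 0)"

definition orbit where
  "orbit T X x = (\<Union>t\<in>T. reach X x t 0)"

lemma orbit_upto_subset: "orbit_upto T X x s \<subseteq> orbit T X x"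
  unfolding orbit_upto_def orbit_def by blast

lemma time_setD:
  assumes "time_set T"
  shows time_set_zero: "0 \<in> T"
    and time_set_nonneg: "\<And>t. t \<in> T \<Longrightarrow> 0 \<le> t"
    and time_set_add: "\<And>s t. s \<in> T \<Longrightarrow> t \<in> T \<Longrightarrow> s + t \<in> T"
    and time_set_of_nat: "\<And>k. real k \<in> T"
  using assms unfolding time_set_def by (auto elim: Nats_cases)

lemma long_times_of_nat:
  assumes "time_set T" "N \<le> k"
  shows "real k \<in> long_times T N"
proof -
  let ?A = "{t \<in> T. 0 \<le> t \<and> t \<le> real k}"
  have "N \<le> card ?A" if "finite ?A"
  proof -
    have "real ` {..k} \<subseteq> ?A"
      using time_set_of_nat[OF assms(1)] by auto
    from card_mono[OF that this] show ?thesis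
      using assms(2) by (simp add: card_image)
  qed
  then show ?thesis
    unfolding long_times_def using time_set_of_nat[OF assms(1)] by auto
qed

text \<open>
  A nonempty family may a priori have no trajectory starting at \<open>x\<close>.  Homogeneity with factor 0
  transfers nonemptiness of the reachable set from one starting point to \<open>0\<close> and from there to
  \<open>x\<close>.
\<close>

lemma mem_orbit_self:
  assumes "time_set T" "O_family T nrm X" "X \<noteq> {}"
  shows "x \<in> orbit T X x"
proof -
  have hom: "reach X (c *\<^sub>R u) 0 0 = (\<lambda>y. c *\<^sub>R y) ` reach X u 0 0" for c u
    using assms(2) time_set_zero[OF assms(1)] unfolding O_family_def by blast
  obtain y where "y \<in> X" using assms(3) by blast
  then have "reach X (0 *\<^sub>R y 0) 0 0 \<noteq> {}"
    unfolding hom by (auto simp: reach_def)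
  then have "reach X (0 *\<^sub>R x) 0 0 \<noteq> {}" by simp
  then have "reach X x 0 0 \<noteq> {}"
    unfolding hom by simp
  then have "x \<in> reach X x 0 0"
    by (auto simp: reach_def)
  then show ?thesis
    unfolding orbit_def using time_set_zero[OF assms(1)] by blast
qed

lemma reach_scaleR:
  assumes "O_family T nrm X" "t \<in> T"
  shows "reach X (c *\<^sub>R u) t 0 = (\<lambda>y. c *\<^sub>R y) ` reach X u t 0"
  using assms unfolding O_family_def by blast

text \<open>Concavity at the midpoint of \<open>2u\<close> and \<open>2v\<close>, with the factors removed by homogeneity.\<close>

lemma reach_add:
  assumes "O_family T nrm X" "t \<in> T" "y \<in> reach X (u + v) t 0"
  obtains a b where "a \<in> reach X u t 0" "b \<in> reach X v t 0" "y = a + b"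
proof -
  let ?h = "1/2 :: real"
  have "\<forall>u v. \<forall>t\<in>T. \<forall>c\<in>{0..1}.
        reach X (c *\<^sub>R u + (1 - c) *\<^sub>R v) t 0
          \<subseteq> (\<lambda>y. c *\<^sub>R y) ` reach X u t 0 + (\<lambda>y. (1 - c) *\<^sub>R y) ` reach X v t 0"
    using assms(1) unfolding O_family_def by blast
  from this[rule_format, of t ?h "2 *\<^sub>R u" "2 *\<^sub>R v"]
  have "reach X (u + v) t 0
      \<subseteq> (\<lambda>y. ?h *\<^sub>R y) ` reach X (2 *\<^sub>R u) t 0 + (\<lambda>y. ?h *\<^sub>R y) ` reach X (2 *\<^sub>R v) t 0"
    using assms(2) by simp
  also have "\<dots> = reach X u t 0 + reach X v t 0"
    by (simp add: reach_scaleR[OF assms(1,2)] image_image)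
  finally show ?thesis
    using assms(3) that by (auto elim!: set_plus_elim)
qed

text \<open>
  The second trajectory is moved by time invariance to start at time \<open>s\<close>, then sewn to the first.
\<close>

lemma reach_trans:
  assumes T: "time_set T" and O: "O_family T nrm X"
    and st: "s \<in> T" "t \<in> T" and y: "y \<in> reach X x s 0" and z: "z \<in> reach X y t 0"
  shows "z \<in> reach X x (s + t) 0"
proof -
  have "0 \<le> s" "0 \<le> t" "s + t \<in> T"
    using T st time_setD by blast+
  have "\<forall>u. \<forall>s\<in>T. \<forall>t\<in>T. s \<le> t \<longrightarrow> reach X u t s = reach X u (t - s) 0"
    using O unfolding O_family_def by blast
  from this[rule_format, of s "s + t" y] have "z \<in> reach X y (s + t) s"
    using z st \<open>s + t \<in> T\<close> \<open>0 \<le> t\<close> by simp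
  then obtain q where q: "q \<in> X" "q s = y" "q (s + t) = z"
    unfolding reach_def by auto
  obtain p where p: "p \<in> X" "p 0 = x" "p s = y"
    using y unfolding reach_def by auto
  have "\<forall>t1\<in>T. \<forall>t2\<in>T. \<forall>t3\<in>T. t1 \<le> t2 \<longrightarrow> t2 \<le> t3 \<longrightarrow>
        (\<forall>x\<in>X. \<forall>y\<in>X. x t2 = y t2 \<longrightarrow>
           (\<exists>z\<in>X. (\<forall>t\<in>T. t1 \<le> t \<and> t \<le> t2 \<longrightarrow> z t = x t) \<and>
                  (\<forall>t\<in>T. t2 \<le> t \<and> t \<le> t3 \<longrightarrow> z t = y t)))"
    by (rule conjunct1[OF O[unfolded O_family_def]])
  from this[rule_format, of 0 s "s + t" p q] obtain w where
    w: "w \<in> X" "\<And>r. r \<in> T \<Longrightarrow> 0 \<le> r \<Longrightarrow> r \<le> s \<Longrightarrow> w r = p r"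
       "\<And>r. r \<in> T \<Longrightarrow> s \<le> r \<Longrightarrow> r \<le> s + t \<Longrightarrow> w r = q r"
    using time_set_zero[OF T] st \<open>0 \<le> s\<close> \<open>0 \<le> t\<close> \<open>s + t \<in> T\<close> p q by auto
  have "w 0 = x" "w (s + t) = z"
    using w(2)[of 0] w(3)[of "s + t"] p q time_set_zero[OF T] \<open>0 \<le> s\<close> \<open>0 \<le> t\<close> \<open>s + t \<in> T\<close> by auto
  then show ?thesis
    using w(1) unfolding reach_def by blast
qed

lemma orbit_mono:
  assumes "time_set T" "O_family T nrm X" "z \<in> orbit T X u"
  shows "orbit T X z \<subseteq> orbit T X u"
proof
  fix w assume "w \<in> orbit T X z"
  then obtain t where t: "t \<in> T" "w \<in> reach X z t 0"
    unfolding orbit_def by blast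
  obtain s where s: "s \<in> T" "z \<in> reach X u s 0"
    using assms(3) unfolding orbit_def by blast
  have "w \<in> reach X u (s + t) 0"
    by (rule reach_trans[OF assms(1,2) s(1) t(1) s(2) t(2)])
  then show "w \<in> orbit T X u"
    unfolding orbit_def using time_set_add[OF assms(1) s(1) t(1)] by blast
qed

lemma orbit_scaleR:
  assumes "O_family T nrm X"
  shows "orbit T X (c *\<^sub>R u) = (\<lambda>y. c *\<^sub>R y) ` orbit T X u"
  unfolding orbit_def using reach_scaleR[OF assms] by (auto simp: image_UN)

lemma orbit_add:
  assumes "O_family T nrm X" "y \<in> orbit T X (u + v)"
  obtains a b where "a \<in> orbit T X u" "b \<in> orbit T X v" "y = a + b"
proof -
  obtain t where t: "t \<in> T" "y \<in> reach X (u + v) t 0"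
    using assms(2) unfolding orbit_def by blast
  obtain a b where "a \<in> reach X u t 0" "b \<in> reach X v t 0" "y = a + b"
    using reach_add[OF assms(1) t] .
  then show ?thesis
    using that t(1) unfolding orbit_def by blast
qed

text \<open>
  From a linear combination of orbit points one reaches only combinations of points reachable
  from these, and the latter lie in the orbit by transitivity.
\<close>

lemma invariant_span_orbit:
  assumes T: "time_set T" and O: "O_family T nrm X"
  shows "invariant_subspace T X (span (orbit T X x))"
proof -
  have "reach X y t 0 \<subseteq> span (orbit T X x)" if y: "y \<in> span (orbit T X x)" and t: "t \<in> T" for y t
    using y
  proof (induction rule: span_induct_alt)
    case base
    have "reach X (0 *\<^sub>R 0) t 0 \<subseteq> {0}"
      unfolding reach_scaleR[OF O t] by auto
    then show ?case
      using span_zero by auto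
  next
    case (step c a b)
    show ?case
    proof
      fix w assume "w \<in> reach X (c *\<^sub>R a + b) t 0"
      then obtain p q where pq: "p \<in> reach X (c *\<^sub>R a) t 0" "q \<in> reach X b t 0" "w = p + q"
        using reach_add[OF O t] by blast
      obtain p' where p': "p' \<in> reach X a t 0" "p = c *\<^sub>R p'"
        using pq(1) unfolding reach_scaleR[OF O t] by blast
      have "p' \<in> orbit T X x"
        using p'(1) t orbit_mono[OF T O step(1)] unfolding orbit_def by blast
      then show "w \<in> span (orbit T X x)"
        using pq p' step.IH by (auto intro: span_add span_scale span_base)
    qed
  qed
  then show ?thesis
    unfolding invariant_subspace_def by (auto simp: subspace_span)
qed

lemma span_orbit_eq_UNIV:
  assumes "time_set T" "O_family T nrm X" "quasi_controllable T X" "X \<noteq> {}" "x \<noteq> 0"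
  shows "span (orbit T X x) = UNIV"
proof -
  have "x \<in> span (orbit T X x)"
    by (simp add: span_base mem_orbit_self[OF assms(1,2,4)])
  then show ?thesis
    using assms(3,5) invariant_span_orbit[OF assms(1,2)] unfolding quasi_controllable_def by blast
qed

section \<open>Stability bounds and the quasi-controllability measures\<close>

lemma stability_bound_iff:
  assumes "is_norm nrm" "0 < \<mu>"
  shows "stability_bound T nrm X \<mu> \<longleftrightarrow> (\<forall>x. \<forall>u\<in>orbit T X x. nrm u \<le> \<mu> * nrm x)"
proof -
  have "0 \<le> \<mu> * nrm x" for x
    using assms unfolding is_norm_def by auto
  then show ?thesis
    unfolding stability_bound_def orbit_def SUP_le_iff by simp
qed

definition inner_radii where
  "inner_radii T nrm X x s = {\<rho>. nrm_ball nrm \<rho> \<subseteq> absco (orbit_upto T X x s)}"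

lemma qcm_s_eq: "qcm_s T nrm X s = (INF x\<in>{x. nrm x = 1}. Sup (inner_radii T nrm X x s))"
  unfolding qcm_s_def inner_radii_def orbit_upto_def ..

text \<open>
  The sublevel sets of a seminorm are convex and symmetric.  The lemma is applied both to the given
  norm and to the supremum of that norm over orbits.
\<close>

lemma seminorm_le_on_absco:
  fixes f :: "real ^ 'n \<Rightarrow> real"
  assumes add: "\<And>x y. f (x + y) \<le> f x + f y"
    and scale: "\<And>c x. f (c *\<^sub>R x) \<le> \<bar>c\<bar> * f x"
    and bound: "\<And>w. w \<in> W \<Longrightarrow> f w \<le> b"
    and w: "w \<in> absco W"
  shows "f w \<le> b"
proof -
  have "convex {w. f w \<le> b}"
  proof (rule convexI)
    fix x y and a c :: real
    assume *: "x \<in> {w. f w \<le> b}" "y \<in> {w. f w \<le> b}" "0 \<le> a" "0 \<le> c" "a + c = 1"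
    have "f (a *\<^sub>R x + c *\<^sub>R y) \<le> a * f x + c * f y"
      using add[of "a *\<^sub>R x" "c *\<^sub>R y"] scale[of a x] scale[of c y] *(3,4) by simp
    also have "\<dots> \<le> b"
      using * by (intro convex_bound_le) auto
    finally show "a *\<^sub>R x + c *\<^sub>R y \<in> {w. f w \<le> b}" by simp
  qed
  moreover have "W \<union> uminus ` W \<subseteq> {w. f w \<le> b}"
    using bound scale[of "-1"] by (auto intro: order_trans)
  ultimately have "absco W \<subseteq> {w. f w \<le> b}"
    unfolding absco_def by (rule hull_minimal[rotated])
  then show ?thesis using w by blast
qed

text \<open>The orbit, hence its hull, lies in the ball of radius \<open>\<mu>\<close>.\<close>

lemma inner_radii_upper:
  assumes "is_norm nrm" "0 < \<mu>" "stability_bound T nrm X \<mu>" "nrm x = 1"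
    and "\<rho> \<in> inner_radii T nrm X x s"
  shows "\<rho> \<le> \<mu>"
proof (cases "0 \<le> \<rho>")
  case True
  obtain p where p: "nrm p = \<rho>"
    using is_norm_attains[OF assms(1) True] .
  then have mem: "p \<in> absco (orbit_upto T X x s)"
    using assms(5) unfolding inner_radii_def nrm_ball_def by auto
  have bound: "nrm u \<le> \<mu>" if "u \<in> orbit_upto T X x s" for u
  proof -
    have "u \<in> orbit T X x"
      using that orbit_upto_subset by blast
    then have "nrm u \<le> \<mu> * nrm x"
      using assms(3) stability_bound_iff[OF assms(1,2)] by blast
    then show ?thesis using assms(4) by simp
  qed
  have "nrm (x + y) \<le> nrm x + nrm y" "nrm (a *\<^sub>R x) \<le> \<bar>a\<bar> * nrm x" for x y a
    using assms(1) unfolding is_norm_def by simp_all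
  then have "nrm p \<le> \<mu>"
    by (rule seminorm_le_on_absco[OF _ _ bound mem])
  then show ?thesis using p by simp
qed (use assms in simp)

text \<open>
  A ball of negative radius is empty.  This keeps the set of radii nonempty and its supremum
  nonnegative even when the hull is empty or has empty interior.
\<close>

lemma inner_radii_negative:
  assumes "is_norm nrm" "\<rho> < 0"
  shows "\<rho> \<in> inner_radii T nrm X x s"
proof -
  have "\<not> nrm y \<le> \<rho>" for y
    using assms unfolding is_norm_def by (meson leD le_less_trans)
  then show ?thesis
    unfolding inner_radii_def nrm_ball_def by auto
qed

lemma Sup_inner_radii_bounds:
  assumes "is_norm nrm" "0 < \<mu>" "stability_bound T nrm X \<mu>" "nrm x = 1"
  shows "bdd_above (inner_radii T nrm X x s)"
    and "0 \<le> Sup (inner_radii T nrm X x s)" and "Sup (inner_radii T nrm X x s) \<le> \<mu>"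
proof -
  let ?R = "inner_radii T nrm X x s"
  show bdd: "bdd_above ?R"
    by (rule bdd_aboveI[where M = \<mu>]) (rule inner_radii_upper[OF assms])
  show "0 \<le> Sup ?R"
  proof (rule field_le_epsilon)
    fix e :: real assume "0 < e"
    then have "- e \<le> Sup ?R"
      by (intro cSup_upper bdd inner_radii_negative[OF assms(1)]) simp
    then show "0 \<le> Sup ?R + e" by simp
  qed
  show "Sup ?R \<le> \<mu>"
  proof (rule cSup_least)
    show "?R \<noteq> {}"
      using inner_radii_negative[OF assms(1), of "-1"] by force
  qed (rule inner_radii_upper[OF assms])
qed

lemma qcm_s_le_Sup_inner_radii:
  assumes "is_norm nrm" "0 < \<mu>" "stability_bound T nrm X \<mu>" "nrm x = 1"
  shows "qcm_s T nrm X s \<le> Sup (inner_radii T nrm X x s)"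
proof -
  have "bdd_below ((\<lambda>x. Sup (inner_radii T nrm X x s)) ` {x. nrm x = 1})"
    by (rule bdd_belowI2[where m = 0]) (rule Sup_inner_radii_bounds(2)[OF assms(1-3)], simp)
  then show ?thesis
    unfolding qcm_s_eq by (rule cINF_lower) (simp add: assms(4))
qed

lemma qcm_s_bounds:
  assumes "is_norm nrm" "0 < \<mu>" "stability_bound T nrm X \<mu>"
  shows "0 \<le> qcm_s T nrm X s" and "qcm_s T nrm X s \<le> \<mu>"
proof -
  obtain x where x: "nrm x = 1"
    using is_norm_attains[OF assms(1), of 1] by auto
  show "0 \<le> qcm_s T nrm X s"
    unfolding qcm_s_eq using x
    by (intro cINF_greatest) (auto intro: Sup_inner_radii_bounds(2)[OF assms])
  show "qcm_s T nrm X s \<le> \<mu>"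
    using qcm_s_le_Sup_inner_radii[OF assms x] Sup_inner_radii_bounds(3)[OF assms x]
    by (rule order_trans)
qed

lemma qcm_s_le_qcm:
  assumes "is_norm nrm" "0 < \<mu>" "stability_bound T nrm (X :: (real \<Rightarrow> real^'n) set) \<mu>"
    and "s \<in> long_times T CARD('n)"
  shows "qcm_s T nrm X s \<le> qcm T nrm X"
proof -
  have "bdd_above (qcm_s T nrm X ` long_times T CARD('n))"
    by (rule bdd_aboveI2[where M = \<mu>]) (rule qcm_s_bounds(2)[OF assms(1-3)])
  with assms(4) show ?thesis
    unfolding qcm_def by (rule cSUP_upper)
qed

section \<open>Positivity of the quasi-controllability measure\<close>

text \<open>
  Quantitative form of the failure to contain a ball: a point near 0 outside the hull gives a unit
  functional that is small on all of \<open>W\<close>, because the hull is symmetric.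
\<close>

lemma separate_from_absco:
  assumes "p \<notin> absco W" "W \<noteq> {}"
  obtains f where "norm f = 1" "\<And>w. w \<in> W \<Longrightarrow> \<bar>f \<bullet> w\<bar> \<le> norm p"
proof -
  have sub: "W \<union> uminus ` W \<subseteq> absco W"
    unfolding absco_def by (rule hull_subset)
  have "convex (absco W)"
    unfolding absco_def by (rule convex_convex_hull)
  moreover have "absco W \<noteq> {}" "absco W \<inter> {p} = {}"
    using assms sub by blast+
  ultimately have "\<exists>a b. a \<noteq> 0 \<and> (\<forall>w\<in>absco W. a \<bullet> w \<le> b) \<and> (\<forall>w\<in>{p}. b \<le> a \<bullet> w)"
    by (intro separating_hyperplane_sets) simp_all
  then obtain a b where a: "a \<noteq> 0" "\<And>w. w \<in> absco W \<Longrightarrow> a \<bullet> w \<le> b" "b \<le> a \<bullet> p"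
    by blast
  show ?thesis
  proof
    show "norm (inverse (norm a) *\<^sub>R a) = 1"
      using a(1) by simp
    fix w assume "w \<in> W"
    then have "w \<in> absco W" "- w \<in> absco W"
      using sub by auto
    then have "\<bar>a \<bullet> w\<bar> \<le> a \<bullet> p"
      using a(2)[of w] a(2)[of "- w"] a(3) by auto
    also have "\<dots> \<le> norm a * norm p"
      by (rule norm_cauchy_schwarz)
    finally show "\<bar>(inverse (norm a) *\<^sub>R a) \<bullet> w\<bar> \<le> norm p"
      using a(1) by (simp add: abs_mult field_simps)
  qed
qed

lemma reach_nearby:
  assumes O: "O_family T nrm X" and "t \<in> T" "y \<in> reach X x t 0" "xs \<longlonglongrightarrow> x" "0 < e"
  shows "\<forall>\<^sub>F n in sequentially. \<exists>a\<in>reach X (xs n) t 0. nrm (a - y) < e"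
proof -
  let ?H = "\<lambda>n. hausdorff nrm (reach X (xs n) t 0) (reach X x t 0)"
  have "\<forall>xs x0. xs \<longlonglongrightarrow> x0 \<longrightarrow>
      (\<forall>t\<in>T. (\<lambda>n. hausdorff nrm (reach X (xs n) t 0) (reach X x0 t 0)) \<longlonglongrightarrow> 0)"
    using O unfolding O_family_def by (elim conjE)
  then have "?H \<longlonglongrightarrow> 0"
    using assms(2,4) by blast
  then have "\<forall>\<^sub>F n in sequentially. ?H n < ennreal e"
    using assms(5) by (intro order_tendstoD) auto
  then show ?thesis
  proof eventually_elim
    case (elim n)
    have "(INF a\<in>reach X (xs n) t 0. ennreal (nrm (a - y)))
        \<le> (SUP b\<in>reach X x t 0. INF a\<in>reach X (xs n) t 0. ennreal (nrm (a - b)))"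
      using assms(3) by (rule SUP_upper)
    also have "\<dots> \<le> ?H n"
      unfolding hausdorff_def by (rule max.cobounded2)
    finally have "(INF a\<in>reach X (xs n) t 0. ennreal (nrm (a - y))) < ennreal e"
      using elim by (rule le_less_trans)
    then show ?case
      unfolding INF_less_iff by (meson ennreal_leI not_le)
  qed
qed

text \<open>
  The functionals replace a direct estimate of how the inner radius varies with the starting point:
  only a limit of unit functionals has to be taken, and orthogonality to an orbit passes to the
  limit pointwise, without any uniformity in time.
\<close>

lemma qcm_pos:
  fixes X :: "(real \<Rightarrow> real ^ 'n) set"
  assumes T: "time_set T" and nrm: "is_norm nrm" and O: "O_family T nrm X"
    and Q: "quasi_controllable T X" and X: "X \<noteq> {}"
    and \<mu>: "0 < \<mu>" "stability_bound T nrm X \<mu>"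
  shows "0 < qcm T nrm X"
proof (rule ccontr)
  assume "\<not> 0 < qcm T nrm X"
  \<comment> \<open>The offset keeps every \<open>s n\<close> among the admissible times, also for integer time.\<close>
  define s where "s n = real (n + CARD('n))" for n
  obtain c where c: "c > 0" "\<And>x. norm x \<le> c * nrm x"
    using is_norm_dominates_norm[OF nrm] by blast
  have "\<exists>x f. nrm x = 1 \<and> norm f = 1 \<and>
          (\<forall>w\<in>orbit_upto T X x (s n). \<bar>f \<bullet> w\<bar> \<le> c * inverse (real (Suc n)))" for n
  proof -
    have "s n \<in> long_times T CARD('n)"
      unfolding s_def by (rule long_times_of_nat[OF T]) simp
    then have "qcm_s T nrm X (s n) < inverse (real (Suc n))"
      using qcm_s_le_qcm[OF nrm \<mu>] \<open>\<not> 0 < qcm T nrm X\<close>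
      by (smt (verit) inverse_positive_iff_positive of_nat_0_less_iff zero_less_Suc)
    moreover obtain x0 where "nrm x0 = 1"
      using is_norm_attains[OF nrm, of 1] by auto
    ultimately obtain x where x: "nrm x = 1"
      "Sup (inner_radii T nrm X x (s n)) < inverse (real (Suc n))"
      unfolding qcm_s_eq by (subst (asm) cINF_less_iff)
        (auto intro: bdd_belowI2[where m = 0] Sup_inner_radii_bounds(2)[OF nrm \<mu>])
    then have "inverse (real (Suc n)) \<notin> inner_radii T nrm X x (s n)"
      using cSup_upper[OF _ Sup_inner_radii_bounds(1)[OF nrm \<mu> x(1)]] by (meson leD)
    then obtain p where p: "nrm p \<le> inverse (real (Suc n))" "p \<notin> absco (orbit_upto T X x (s n))"
      unfolding inner_radii_def nrm_ball_def by auto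
    have "norm p \<le> c * inverse (real (Suc n))"
      using c(2)[of p] p(1) c(1) by (meson less_eq_real_def mult_left_mono order_trans)
    moreover obtain f :: "real^'n" where "norm f = 1"
      "\<And>w. w \<in> orbit_upto T X x (s n) \<Longrightarrow> \<bar>f \<bullet> w\<bar> \<le> norm p"
      \<comment> \<open>With no points to bound, any unit vector serves as the functional.\<close>
    proof (cases "orbit_upto T X x (s n) = {}")
      case True
      then show ?thesis
        using that vector_choose_size[of 1] by auto
    qed (use separate_from_absco[OF p(2)] in blast)
    ultimately show ?thesis
      using x(1) by (meson order_trans)
  qed
  then obtain xs f where xs: "\<And>n. nrm (xs n) = 1" and f: "\<And>n. norm (f n) = 1"
    and small: "\<And>n w. w \<in> orbit_upto T X (xs n) (s n) \<Longrightarrow> \<bar>f n \<bullet> w\<bar> \<le> c * inverse (real (Suc n))"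
    by metis

  have cpt: "compact ({x. nrm x = 1} \<times> sphere (0 :: real^'n) 1)"
    by (intro compact_Times is_norm_compact_sphere[OF nrm]) simp
  have "\<forall>n. (xs n, f n) \<in> {x. nrm x = 1} \<times> sphere 0 1"
    using xs f by simp
  then obtain l r where l: "l \<in> {x. nrm x = 1} \<times> sphere (0 :: real^'n) 1"
    and r: "strict_mono (r :: nat \<Rightarrow> nat)" and lim: "((\<lambda>n. (xs n, f n)) \<circ> r) \<longlonglongrightarrow> l"
    by (rule seq_compactE[OF compact_imp_seq_compact[OF cpt]])
  define x g where "x = fst l" and "g = snd l"
  have lim_x: "(\<lambda>n. xs (r n)) \<longlonglongrightarrow> x" and lim_g: "(\<lambda>n. f (r n)) \<longlonglongrightarrow> g"
    using tendsto_fst[OF lim] tendsto_snd[OF lim] unfolding x_def g_def by (simp_all add: o_def)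

  have "g \<bullet> y = 0" if y: "y \<in> orbit T X x" for y
  proof -
    obtain t where t: "t \<in> T" "y \<in> reach X x t 0"
      using y unfolding orbit_def by blast
    have "(\<lambda>n. f (r n) \<bullet> y) \<longlonglongrightarrow> 0"
    proof (rule tendstoI)
      fix e :: real assume e: "0 < e"
      then have "0 < e / 2 / c" using c by simp
      note near = reach_nearby[OF O t lim_x this]
      have "(\<lambda>n. c * inverse (real (Suc n))) \<longlonglongrightarrow> 0"
        using tendsto_mult_right_zero[OF LIMSEQ_inverse_real_of_nat] .
      then have small': "\<forall>\<^sub>F n in sequentially. c * inverse (real (Suc n)) < e / 2"
        using e by (intro order_tendstoD) auto
      have "\<forall>\<^sub>F n in sequentially. t \<le> real n"
        by (rule eventually_sequentiallyI[of "nat \<lceil>t\<rceil>"]) linarith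
      with near small' show "\<forall>\<^sub>F n in sequentially. dist (f (r n) \<bullet> y) 0 < e"
      proof eventually_elim
        case (elim n)
        then obtain a where a: "a \<in> reach X (xs (r n)) t 0" "nrm (a - y) < e / 2 / c"
          by blast
        have nr: "n \<le> r n" using r by (rule seq_suble)
        have "a \<in> orbit_upto T X (xs (r n)) (s (r n))"
          unfolding orbit_upto_def s_def using a t elim nr time_set_nonneg[OF T] by fastforce
        then have "\<bar>f (r n) \<bullet> a\<bar> \<le> c * inverse (real (Suc (r n)))"
          by (rule small)
        also have "\<dots> \<le> c * inverse (real (Suc n))"
          using nr c by (simp add: field_simps)
        finally have "\<bar>f (r n) \<bullet> a\<bar> < e / 2"
          using elim by simp
        moreover have "\<bar>f (r n) \<bullet> (a - y)\<bar> \<le> norm (a - y)"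
          using Cauchy_Schwarz_ineq2[of "f (r n)" "a - y"] f by simp
        moreover have "norm (a - y) < e / 2"
          using c(2)[of "a - y"] a(2) c(1) by (simp add: field_simps)
        ultimately show ?case
          by (simp add: inner_diff_right)
      qed
    qed
    moreover have "(\<lambda>n. f (r n) \<bullet> y) \<longlonglongrightarrow> g \<bullet> y"
      by (intro tendsto_intros lim_g)
    ultimately show ?thesis
      by (rule LIMSEQ_unique[symmetric])
  qed
  then have "span (orbit T X x) \<subseteq> {y. g \<bullet> y = 0}"
    by (intro span_minimal subspace_hyperplane) auto
  moreover have "x \<noteq> 0"
  proof
    assume "x = 0"
    then have "nrm x = 0"
      using nrm unfolding is_norm_def by blast
    then show False
      using l unfolding x_def by auto
  qed
  ultimately have "g \<bullet> g = 0"
    using span_orbit_eq_UNIV[OF T O Q X] by blast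
  then show False
    using l unfolding g_def by auto
qed

section \<open>Overshooting against inner radii\<close>

definition peak where
  "peak T nrm X u = (SUP z\<in>orbit T X u. nrm z)"

text \<open>
  The constant \<open>\<mu>\<close> enters only through the boundedness of orbits; the new constant comes from using the ball
  inclusion at every point of an orbit, not just at its start.
\<close>

lemma stability_bound_inverse_radius:
  fixes X :: "(real \<Rightarrow> real ^ 'n) set"
  assumes T: "time_set T" and nrm: "is_norm nrm" and O: "O_family T nrm X" and X: "X \<noteq> {}"
    and \<mu>: "0 < \<mu>" "stability_bound T nrm X \<mu>"
    and r: "0 < r" "r < qcm_s T nrm X s"
  shows "stability_bound T nrm X (inverse r)"
proof -
  let ?g = "peak T nrm X"
  note self = mem_orbit_self[OF T O X]
  have nrm_scale: "nrm (a *\<^sub>R x) = \<bar>a\<bar> * nrm x" and nrm_ge0: "0 \<le> nrm x"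
    and nrm_add: "nrm (x + y) \<le> nrm x + nrm y" and nrm0: "nrm x = 0 \<longleftrightarrow> x = 0" for a x y
    using nrm unfolding is_norm_def by auto
  have bdd: "bdd_above (nrm ` orbit T X u)" for u
    using \<mu> stability_bound_iff[OF nrm \<mu>(1)] by (auto intro!: bdd_aboveI2)
  have upper: "nrm z \<le> ?g u" if "z \<in> orbit T X u" for z u
    unfolding peak_def using that bdd by (rule cSUP_upper)
  have least: "?g u \<le> b" if "\<And>z. z \<in> orbit T X u \<Longrightarrow> nrm z \<le> b" for u b
    unfolding peak_def using that self by (intro cSUP_least) auto
  have g_scale_le: "?g (a *\<^sub>R u) \<le> \<bar>a\<bar> * ?g u" for a u
    by (rule least) (auto simp: orbit_scaleR[OF O] nrm_scale intro!: mult_left_mono upper)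
  have g_mono: "?g z \<le> ?g u" if "z \<in> orbit T X u" for z u
    using orbit_mono[OF T O that] by (intro least upper) auto
  have g_add: "?g (u + v) \<le> ?g u + ?g v" for u v
  proof (rule least)
    fix z assume "z \<in> orbit T X (u + v)"
    then obtain a b where "a \<in> orbit T X u" "b \<in> orbit T X v" "z = a + b"
      using orbit_add[OF O] by blast
    then show "nrm z \<le> ?g u + ?g v"
      using upper[of a u] upper[of b v] nrm_add[of a b] by simp
  qed
  have g_absco: "?g w \<le> ?g z" if "w \<in> absco (orbit T X z)" for w z
    by (rule seminorm_le_on_absco[of ?g, OF g_add g_scale_le g_mono that])
  have ball: "w \<in> absco (orbit T X z)" if z: "nrm z = 1" and w: "nrm w \<le> r" for z w
  proof -
    have "r < Sup (inner_radii T nrm X z s)"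
      using qcm_s_le_Sup_inner_radii[OF nrm \<mu> z] r(2) by (rule less_le_trans[rotated])
    then obtain \<rho> where "\<rho> \<in> inner_radii T nrm X z s" "r < \<rho>"
      using less_cSupD inner_radii_negative[OF nrm, of "-1"] by (metis empty_iff neg_less_0_iff_less zero_less_one)
    then have "w \<in> absco (orbit_upto T X z s)"
      using w unfolding inner_radii_def nrm_ball_def by auto
    moreover have "absco (orbit_upto T X z s) \<subseteq> absco (orbit T X z)"
      unfolding absco_def using orbit_upto_subset[of T X z s] by (intro hull_mono) auto
    ultimately show ?thesis by blast
  qed
  \<comment> \<open>Scale \<open>z\<close> to norm 1 and \<open>w\<close> to norm \<open>r\<close>, so that \<open>w\<close> falls into the hull of the orbit of \<open>z\<close>.\<close>
  have key: "r * ?g w * nrm z \<le> ?g z * nrm w" if "w \<noteq> 0" "z \<noteq> 0" for w z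
  proof -
    have pos: "nrm w > 0" "nrm z > 0"
      using that nrm0 nrm_ge0 by (metis less_eq_real_def)+
    let ?w = "(r / nrm w) *\<^sub>R w" and ?z = "inverse (nrm z) *\<^sub>R z"
    have "?g w = ?g ((nrm w / r) *\<^sub>R ?w)"
      using pos r by simp
    also have "\<dots> \<le> nrm w / r * ?g ?w"
      using g_scale_le[of "nrm w / r" ?w] pos r by simp
    also have "?g ?w \<le> ?g ?z"
      using pos r by (intro g_absco ball) (auto simp: nrm_scale)
    also have "?g ?z \<le> inverse (nrm z) * ?g z"
      using g_scale_le[of "inverse (nrm z)" z] pos by simp
    finally show ?thesis
      using pos r by (simp add: field_simps)
  qed
  have "?g w \<le> inverse r * nrm w" if "w \<noteq> 0" for w
  proof -
    have wpos: "nrm w > 0"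
      using that nrm0 nrm_ge0 by (metis less_eq_real_def)
    then have gpos: "?g w > 0"
      using upper[OF self] by (rule less_le_trans)
    \<comment> \<open>Self-improvement: \<open>key\<close> bounds every \<open>nrm z\<close> on the orbit of \<open>w\<close>, hence their supremum \<open>?g w\<close>.\<close>
    have "?g w \<le> ?g w * nrm w / (r * ?g w)"
    proof (rule least)
      fix z assume z: "z \<in> orbit T X w"
      show "nrm z \<le> ?g w * nrm w / (r * ?g w)"
      proof (cases "z = 0")
        case True
        then show ?thesis
          using nrm0[of 0] gpos r wpos by simp
      next
        case False
        have "r * ?g w * nrm z \<le> ?g w * nrm w"
          using key[OF that False] mult_right_mono[OF g_mono[OF z] nrm_ge0[of w]] by linarith
        then show ?thesis
          using gpos r by (simp add: field_simps)
      qed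
    qed
    then show ?thesis
      using gpos r by (simp add: field_simps)
  qed
  moreover have "nrm u \<le> inverse r * nrm 0" if "u \<in> orbit T X 0" for u
    using that \<mu> stability_bound_iff[OF nrm \<mu>(1)] nrm0[of 0] by fastforce
  ultimately have "\<forall>w. \<forall>u\<in>orbit T X w. nrm u \<le> inverse r * nrm w"
    using upper by (metis order_trans)
  then show ?thesis
    using stability_bound_iff[OF nrm] r by simp
qed

theorem theorem3p2:
  fixes T :: "real set"
    and nrm :: "real ^ 'n \<Rightarrow> real"
    and X :: "(real \<Rightarrow> real ^ 'n) set"
  assumes "time_set T"
    and "is_norm nrm"
    and "O_family T nrm X"
    and "quasi_controllable T X"
    and "lyapunov_stable T nrm X"
  shows "ovm T nrm X \<le> inverse (qcm T nrm X)"
proof -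
  let ?q = "qcm T nrm X"
  obtain \<mu> where \<mu>: "0 < \<mu>" "stability_bound T nrm X \<mu>"
    using assms(5) unfolding lyapunov_stable_def by blast
  have long: "real CARD('n) \<in> long_times T CARD('n)"
    by (rule long_times_of_nat[OF assms(1)]) simp
  have ovm_le: "ovm T nrm X \<le> m" if "0 < m" "stability_bound T nrm X m" for m
    unfolding ovm_def using that by (intro cInf_lower bdd_belowI[where m = 0]) auto
  show ?thesis
  proof (cases "X = {}")
    case True
    \<comment> \<open>Every \<open>m > 0\<close> is a stability bound, so the left side is at most 0, and the right side is
      nonnegative because \<open>qcm\<close> is.\<close>
    have "stability_bound T nrm X m" if "0 < m" for m
      using stability_bound_iff[OF assms(2) that] True by (simp add: orbit_def reach_def)
    then have "ovm T nrm X \<le> 0 + m" if "0 < m" for m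
      using ovm_le that by simp
    then have "ovm T nrm X \<le> 0"
      by (rule field_le_epsilon)
    moreover have "0 \<le> ?q"
      using qcm_s_bounds(1)[OF assms(2) \<mu>] qcm_s_le_qcm[OF assms(2) \<mu> long] by (rule order_trans)
    ultimately show ?thesis
      by (meson inverse_nonnegative_iff_nonnegative order_trans)
  next
    case False
    have pos: "0 < ?q"
      by (rule qcm_pos[OF assms(1-4) False \<mu>])
    have bound: "ovm T nrm X * r \<le> 1" if r: "0 < r" "r < ?q" for r
    proof -
      obtain s where "r < qcm_s T nrm X s"
        using less_cSupD[of "qcm_s T nrm X ` long_times T CARD('n)" r] long r(2)
        unfolding qcm_def by blast
      then have "ovm T nrm X \<le> inverse r"
        using stability_bound_inverse_radius[OF assms(1-3) False \<mu> r(1)] r(1)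
        by (intro ovm_le) auto
      then show ?thesis
        using r(1) by (simp add: field_simps)
    qed
    have "ovm T nrm X * ?q \<le> 1"
    proof (rule ccontr)
      assume "\<not> ovm T nrm X * ?q \<le> 1"
      then have "1 < ovm T nrm X * ?q" by simp
      then have "0 < ovm T nrm X" 
        using pos by (metis less_trans zero_less_mult_pos2 zero_less_one)
      then have "inverse (ovm T nrm X) < ?q"
        using \<open>1 < ovm T nrm X * ?q\<close> by (simp add: field_simps)
      then obtain r where r: "inverse (ovm T nrm X) < r" "r < ?q"
        using dense by blast
      then have "0 < r"
        using \<open>0 < ovm T nrm X\<close> by (meson inverse_positive_iff_positive less_trans)
      then show False
        using bound[OF _ r(2)] r(1) \<open>0 < ovm T nrm X\<close> by (simp add: field_simps)
    qed
    then show ?thesis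
      using pos by (simp add: field_simps)
  qed
qed

end
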